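(* Let $P\subset\mathbb{R}^d$ be a $d$-polytope and $Q\subset\mathbb{R}^e$ an $e$-polytope, both with vertex barycenter at the origin, and let $w_1,\dots,w_n$ be the vertices of $Q$. Take a facet $G$ of $Q$, and assume (after relabeling the vertices of $Q$) that $w_1,\dots,w_g$ are the vertices of $G$. For each $k>g$, that is, for each vertex $w_k$ of $Q$ which is not contained in $G$, choose some facet $F_k$ of $P$. Then the iterated join $$F=(P^1\oplus w_1)*\dots*(P^g\oplus w_g)*((F_{g+1})^{g+1}\oplus w_{g+1})*\dots*((F_n)^n\oplus w_n)$$ is a facet of the wreath product $P\wr Q$, and all facets of $P\wr Q$ arise in this way.
   Context: Polytopes are convex polytopes; a $d$-polytope is a polytope of dimension $d$, and the vertex barycenter is the average of the vertices. (The only facet of a point is the empty face.) Notation: identify $\mathbb{R}^{nd}$ with the set of real $n\times d$ matrices. For $k\in\{1,\dots,n\}$ and $p\in\mathbb{R}^d$ let $p^k\in\mathbb{R}^{nd}$ be the matrix whose $k$-th row is $p$ and all of whose other rows are zero; for $A\subset\mathbb{R}^d$ let $A^k=\{p^k: p\in A\}$. For $x\in\mathbb{R}^{nd}$ and $y\in\mathbb{R}^e$, $x\oplus y\in\mathbb{R}^{nd+e}$ is the concatenated vector, and for a set $B\subset \mathbb{R}^{nd}$, $B\oplus y=\{x\oplus y: x\in B\}$. For disjoint polytopes $R,S\subset\mathbb{R}^{nd+e}$, $R*S$ denotes their joint convex hull $\operatorname{conv}(R\cup S)$. Wreath product of polytopes: if $v_1,\dots,v_m$ are the vertices of $P$ and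 $w_1,\dots,w_n$ those of $Q$, then $$P\wr Q=\operatorname{conv}\{(v_i)^k\oplus w_k : 1\le i\le m,\ 1\le k\le n\}\subset\mathbb{R}^{nd+e}.$$ *)

theory Defs
  imports "HOL-Analysis.Analysis"
begin

text \<open>
  The space $R^d$ is represented by the vectors supported on a set \<open>D\<close> of \<open>d\<close> coordinates;
  \<open>D = UNIV\<close> gives the whole type, and \<open>D = {}\<close> gives $R^0$, which is not of the form
  \<^typ>\<open>real^'d\<close>, as index types are nonempty.
\<close>

definition coord_space :: "'d::finite set \<Rightarrow> (real^'d) set" where
  "coord_space D = {x. \<forall>i. i \<notin> D \<longrightarrow> x $ i = 0}"

definition full_dim_polytope :: "'d::finite set \<Rightarrow> (real^'d) set \<Rightarrow> bool" where
  "full_dim_polytope D P \<longleftrightarrow> polytope P \<and> P \<subseteq> coord_space D \<and> aff_dim P = int (card D)"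

definition vertices :: "'a::real_vector set \<Rightarrow> 'a set" where
  "vertices P = {v. v extreme_point_of P}"

definition vertex_barycenter :: "'a::real_vector set \<Rightarrow> 'a" where
  "vertex_barycenter P = (1 / real (card (vertices P))) *\<^sub>R (\<Sum>v\<in>vertices P. v)"

text \<open>
  Unlike the library's \<^const>\<open>facet_of\<close>, this admits the empty face, which is the only facet
  of a point (recall that \<^term>\<open>aff_dim {} = -1\<close>).
\<close>

definition polytope_facet :: "'a::euclidean_space set \<Rightarrow> 'a set \<Rightarrow> bool" where
  "polytope_facet F S \<longleftrightarrow> F face_of S \<and> aff_dim F = aff_dim S - 1"

lemma polytope_facet_singleton: "polytope_facet F {a} \<longleftrightarrow> F = {}"
  by (auto simp: polytope_facet_def simp flip: aff_dim_empty)

lemma polytope_facet_iff_facet_of: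
  assumes "aff_dim S \<noteq> 0"
  shows "polytope_facet F S \<longleftrightarrow> F facet_of S"
  using assms by (auto simp: polytope_facet_def facet_of_def)

text \<open>
  Real $n \times d$ matrices are elements of \<^typ>\<open>real^'d^'n\<close>, and the concatenation of a matrix
  \<open>x\<close> with a vector \<open>y\<close> is the pair \<open>(x, y)\<close>. Then \<open>row_embed k p\<close> is $p^k$, and
  \<open>block k A y\<close> is $A^k \oplus y$.
\<close>

definition row_embed :: "'n::finite \<Rightarrow> real^'d::finite \<Rightarrow> real^'d^'n" where
  "row_embed k p = (\<chi> i. if i = k then p else 0)"

definition block ::
    "'n::finite \<Rightarrow> (real^'d::finite) set \<Rightarrow> real^'e::finite \<Rightarrow> ((real^'d^'n) \<times> (real^'e)) set" where
  "block k A y = (\<lambda>p. (row_embed k p, y)) ` A"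

text \<open>
  The wreath product of \<open>P\<close> with a polytope whose vertices are labelled, injectively, by \<open>w\<close>.
\<close>

definition wreath ::
    "(real^'d::finite) set \<Rightarrow> ('n::finite \<Rightarrow> real^'e::finite) \<Rightarrow> ((real^'d^'n) \<times> (real^'e)) set" where
  "wreath P w = convex hull {(row_embed k v, w k) | v k. v \<in> vertices P}"

definition polytope_join :: "'a::real_vector set \<Rightarrow> 'a set \<Rightarrow> 'a set" where
  "polytope_join R S = convex hull (R \<union> S)"

text \<open>
  The fold is well defined, since \<open>polytope_join R (polytope_join S T)\<close> is symmetric in \<open>R\<close> and
  \<open>S\<close>; the empty set is neutral on convex sets.
\<close>

definition iterated_join :: "('n::finite \<Rightarrow> 'a::real_vector set) \<Rightarrow> 'a set" where
  "iterated_join B = Finite_Set.fold (\<lambda>k A. polytope_join (B k) A) {} UNIV"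

lemma polytope_join_hull:
  "polytope_join R (convex hull S) = convex hull (R \<union> S)"
  unfolding polytope_join_def using hull_Un_right[of convex R S] by simp

lemma polytope_join_left_commute:
  "polytope_join R (polytope_join S T) = polytope_join S (polytope_join R T)"
  using polytope_join_hull[of R "S \<union> T"] polytope_join_hull[of S "R \<union> T"]
  by (simp add: polytope_join_def Un_left_commute)

lemma iterated_join_eq: "iterated_join B = convex hull (\<Union>k. B k)"
proof -
  interpret comp_fun_commute "\<lambda>k A. polytope_join (B k) A"
    by unfold_locales (auto simp: fun_eq_iff polytope_join_left_commute)
  have "Finite_Set.fold (\<lambda>k A. polytope_join (B k) A) {} K = convex hull (\<Union>k\<in>K. B k)"
    if "finite K" for K
    using that by (induction K) (auto simp: polytope_join_hull)
  then show ?thesis by (simp add: iterated_join_def)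
qed

end

theory Submission
  imports Defs
begin

text \<open>
  Since the origin is a relative interior point of \<open>P\<close>, \<open>Q\<close> and \<open>P \<wr> Q\<close>, a facet of one of these is
  the same as the part \<open>X = {a \<bullet> x = 1}\<close> of a valid inequality \<open>a \<bullet> x \<le> 1\<close> such that \<open>X\<close> spans
  the polytope linearly. A functional \<open>(c, b)\<close> on matrices and vectors is valid for \<open>P \<wr> Q\<close> iff
  \<open>c\<^sub>k \<bullet> p \<le> 1 - b \<bullet> w\<^sub>k\<close> for all \<open>k\<close> and all \<open>p \<in> P\<close>. If \<open>b \<bullet> w\<^sub>k = 1\<close>, this forces \<open>c\<^sub>k = 0\<close>
  on \<open>P\<close>; otherwise \<open>c\<^sub>k\<close> is a positive multiple of a functional that is valid for \<open>P\<close>. The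
  spanning conditions are translated by projections to the rows and by one linear map that kills
  the blocks outside \<open>G\<close>.
\<close>

section \<open>Facets as spanning sections of valid inequalities\<close>

lemma aff_dim_hyperplane_one:
  fixes a :: "'a::euclidean_space"
  assumes "X \<subseteq> {x. a \<bullet> x = 1}"
  shows "aff_dim X = int (dim X) - 1"
proof -
  \<comment> \<open>The hyperplane misses the origin, so inserting \<open>0\<close> raises the
    affine dimension by one, to the linear dimension.\<close>
  have "affine hull X \<subseteq> {x. a \<bullet> x = 1}"
    using assms by (simp add: hull_minimal affine_hyperplane)
  then have "0 \<notin> affine hull X"
    by auto
  moreover have "aff_dim (insert 0 X) = int (dim X)"
    by (simp add: aff_dim_zero hull_inc dim_insert span_0)
  ultimately show ?thesis
    by (simp add: aff_dim_insert)
qed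

text \<open>Spanning gives \<open>dim X = dim S\<close>; this is \<open>aff_dim S\<close> because
  \<open>0\<close> lies in \<open>S\<close>, but \<open>aff_dim X + 1\<close> because
  \<open>X\<close> lies off the origin. The empty facet of \<open>{0}\<close> is included, as
  \<open>span {} = {0}\<close>.\<close>

lemma polytope_facet_hyperplaneI:
  fixes a :: "'a::euclidean_space"
  assumes "convex S" "0 \<in> S" "\<And>x. x \<in> S \<Longrightarrow> a \<bullet> x \<le> 1"
    and "X = S \<inter> {x. a \<bullet> x = 1}" "S \<subseteq> span X"
  shows "polytope_facet X S"
proof -
  have "X face_of S"
    using assms face_of_Int_supporting_hyperplane_le by blast
  moreover have "dim X = dim S"
    using assms by (metis dim_subset dim_span inf_le1 order_antisym)
  moreover have "aff_dim S = int (dim S)"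
    using assms by (simp add: aff_dim_zero hull_inc)
  moreover have "aff_dim X = int (dim X) - 1"
    using assms by (intro aff_dim_hyperplane_one) auto
  ultimately show ?thesis
    by (simp add: polytope_facet_def)
qed

text \<open>Use equal weights. The form with a family lets the same facts serve \<open>P\<close>,
  \<open>Q\<close> and the wreath product, with \<open>f\<close> being \<open>id\<close>,
  \<open>w\<close> and \<open>gen\<close>.\<close>

lemma zero_in_hull_centered:
  fixes f :: "'i \<Rightarrow> 'a::real_vector"
  assumes "finite I" "I \<noteq> {}" "sum f I = 0"
  shows "0 \<in> convex hull (f ` I)"
proof -
  have "(\<Sum>i\<in>I. (1 / real (card I)) *\<^sub>R f i) \<in> convex hull (f ` I)"
    using assms by (intro convex_sum) (auto simp: hull_inc)
  then show ?thesis
    using assms by (simp flip: scaleR_sum_right)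
qed

text \<open>Nonpositive numbers with sum zero all vanish, so \<open>a\<close> is zero on the
  generators and hence on their hull.\<close>

lemma nonpos_on_centered_eq_0:
  fixes f :: "'i \<Rightarrow> 'a::real_inner"
  assumes "finite I" "sum f I = 0" "\<And>i. i \<in> I \<Longrightarrow> a \<bullet> f i \<le> 0" "x \<in> convex hull (f ` I)"
  shows "a \<bullet> x = 0"
proof -
  have "(\<Sum>i\<in>I. - (a \<bullet> f i)) = 0"
    using assms by (simp add: sum_negf flip: inner_sum_right)
  then have "f ` I \<subseteq> {x. a \<bullet> x = 0}"
    using assms sum_nonneg_eq_0_iff[of I "\<lambda>i. - (a \<bullet> f i)"] by auto
  then have "convex hull (f ` I) \<subseteq> {x. a \<bullet> x = 0}"
    by (simp add: hull_minimal convex_hyperplane)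
  then show ?thesis
    using assms by auto
qed

text \<open>Faces of polytopes are exposed, and the right-hand side of an exposing inequality can be
  scaled to 1 once it is positive. It is nonnegative since \<open>0\<close> is in the hull; were it
  zero, centering would make the inequality tight everywhere and the facet would be the whole
  hull.\<close>

lemma polytope_facet_centered:
  fixes f :: "'i \<Rightarrow> 'a::euclidean_space"
  assumes "finite I" "I \<noteq> {}" "sum f I = 0" "polytope_facet X (convex hull (f ` I))"
  obtains a where "\<And>x. x \<in> convex hull (f ` I) \<Longrightarrow> a \<bullet> x \<le> 1"
    "X = convex hull (f ` I) \<inter> {x. a \<bullet> x = 1}" "convex hull (f ` I) \<subseteq> span X"
proof -
  let ?S = "convex hull (f ` I)"
  have face: "X face_of ?S" and dim: "aff_dim X = aff_dim ?S - 1"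
    using assms by (auto simp: polytope_facet_def)
  have zero: "0 \<in> ?S"
    using assms by (intro zero_in_hull_centered)
  have "polyhedron ?S"
    using assms by (simp add: polytope_convex_hull polytope_imp_polyhedron)
  then have "X exposed_face_of ?S"
    using face exposed_face_of_polyhedron by blast
  then obtain a \<beta> where sub: "?S \<subseteq> {x. a \<bullet> x \<le> \<beta>}" and X: "X = ?S \<inter> {x. a \<bullet> x = \<beta>}"
    by (auto simp: exposed_face_of_def)
  have "\<beta> \<ge> 0"
    using sub zero by auto
  moreover have "\<beta> \<noteq> 0"
  proof
    assume "\<beta> = 0"
    then have "a \<bullet> f i \<le> 0" if "i \<in> I" for i
      using sub that by (meson hull_inc imageI mem_Collect_eq subsetD)
    then have "X = ?S"
      using nonpos_on_centered_eq_0[of I f a] assms X \<open>\<beta> = 0\<close> by blast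
    then show False
      using dim by simp
  qed
  ultimately have pos: "\<beta> > 0"
    by simp
  define a' where "a' = (1 / \<beta>) *\<^sub>R a"
  have a': "a' \<bullet> x = (a \<bullet> x) / \<beta>" for x
    by (simp add: a'_def)
  have le: "a' \<bullet> x \<le> 1" if "x \<in> ?S" for x
    using sub that pos by (auto simp: a' divide_simps)
  have X': "X = ?S \<inter> {x. a' \<bullet> x = 1}"
    unfolding X a' using pos by auto
  have "aff_dim X = int (dim X) - 1"
    using X' by (intro aff_dim_hyperplane_one) auto
  moreover have "aff_dim ?S = int (dim ?S)"
    by (rule aff_dim_zero[OF hull_inc[OF zero]])
  ultimately have "dim ?S \<le> dim X"
    using dim by simp
  then have "span X = span ?S"
    using X by (intro dim_eq_span) auto
  then show thesis
    using that[OF le X'] span_superset by blast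
qed

text \<open>Extreme points of a face are extreme points of the hull, hence belong to
  \<open>V\<close>; Krein-Milman recovers the face from them.\<close>

lemma hull_Int_face:
  fixes V :: "'a::euclidean_space set"
  assumes "finite V" "X face_of convex hull V"
  shows "X = convex hull (V \<inter> X)"
proof (rule antisym)
  have "compact (convex hull V)"
    using assms by (simp add: finite_imp_compact_convex_hull)
  then have "compact X" "convex X"
    using assms face_of_imp_compact face_of_imp_convex convex_convex_hull by blast+
  then have "X = convex hull {v. v extreme_point_of X}"
    by (rule Krein_Milman_Minkowski)
  also have "\<dots> \<subseteq> convex hull (V \<inter> X)"
    using extreme_point_of_face[OF assms(2)] extreme_point_of_convex_hull
    by (intro hull_mono) blast
  finally show "X \<subseteq> convex hull (V \<inter> X)" .
  show "convex hull (V \<inter> X) \<subseteq> X"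
    using \<open>convex X\<close> by (simp add: hull_minimal)
qed

lemma linear_span_subset:
  assumes "linear h" "h ` X \<subseteq> span Y" "x \<in> span X"
  shows "h x \<in> span Y"
  using assms by (metis imageI linear_span_image span_minimal subspace_span subsetD)

lemma full_dim_polytope_centered:
  fixes P :: "(real^'d::finite) set"
  assumes "full_dim_polytope D P" "vertex_barycenter P = 0"
  shows "P = convex hull (id ` vertices P)" "finite (vertices P)" "vertices P \<noteq> {}"
    "sum id (vertices P) = 0"
proof -
  have "polytope P" "aff_dim P \<ge> 0"
    using assms by (auto simp: full_dim_polytope_def)
  then show fin: "finite (vertices P)"
    by (simp add: vertices_def finite_polyhedron_extreme_points polytope_imp_polyhedron)
  show P: "P = convex hull (id ` vertices P)"
    using \<open>polytope P\<close> Krein_Milman_Minkowski[of P]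
    by (simp add: vertices_def polytope_imp_compact polytope_imp_convex)
  \<comment> \<open>The empty polytope is excluded by its dimension -1, so the factor of the
    barycenter is nonzero and cancels.\<close>
  show "vertices P \<noteq> {}"
    using P \<open>aff_dim P \<ge> 0\<close> by auto
  then show "sum id (vertices P) = 0"
    using fin assms(2) by (simp add: vertex_barycenter_def)
qed

lemma inner_row_embed: "c \<bullet> row_embed k p = c $ k \<bullet> p"
proof -
  have "c \<bullet> row_embed k p = (\<Sum>i\<in>UNIV. c $ i \<bullet> row_embed k p $ i)"
    by (rule inner_vec_def)
  also have "\<dots> = (\<Sum>i\<in>UNIV. if i = k then c $ i \<bullet> p else 0)"
    by (intro sum.cong) (auto simp: row_embed_def)
  finally show ?thesis
    by simp
qed

lemma row_embed_nth: "row_embed k p $ i = (if i = k then p else 0)"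
  by (simp add: row_embed_def)

lemma row_embed_0: "row_embed k 0 = 0"
  by (simp add: vec_eq_iff row_embed_nth)

lemma linear_row_embed: "linear (\<lambda>p. (row_embed k p, 0))"
  by (rule linearI) (auto simp: vec_eq_iff row_embed_nth)

lemma vertices_face: "G face_of Q \<Longrightarrow> v \<in> vertices G \<longleftrightarrow> v \<in> vertices Q \<and> v \<in> G"
  by (auto simp: vertices_def extreme_point_of_face)

section \<open>The wreath product as the hull of a centered family\<close>

locale centered_wreath =
  fixes P :: "(real^'d::finite) set" and Q :: "(real^'e::finite) set"
    and w :: "'n::finite \<Rightarrow> real^'e"
  assumes P_hull: "P = convex hull (id ` vertices P)"
    and finite_vertices_P: "finite (vertices P)"
    and vertices_P: "vertices P \<noteq> {}"
    and sum_vertices_P: "sum id (vertices P) = 0"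
    and Q_hull: "Q = convex hull (range w)"
    and sum_w: "sum w UNIV = 0"
begin

abbreviation gen where "gen \<equiv> \<lambda>(v, k). (row_embed k v, w k)"

lemma wreath_hull: "wreath P w = convex hull (gen ` (vertices P \<times> UNIV))"
  unfolding wreath_def by (rule arg_cong[of _ _ "\<lambda>S. convex hull S"]) auto

lemma finite_index: "finite (vertices P \<times> (UNIV :: 'n set))"
  using finite_vertices_P by simp

text \<open>Every row of the matrix part sums the vertices of \<open>P\<close>, and the vector part
  sums \<open>w\<close> once per vertex of \<open>P\<close>; both vanish.\<close>

lemma sum_gen: "sum gen (vertices P \<times> UNIV) = 0"
proof -
  have "(\<Sum>v\<in>vertices P. \<Sum>k\<in>UNIV. (row_embed k v :: real^'d^'n)) $ i = sum id (vertices P)" for i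
    by (simp add: row_embed_nth)
  then have "(\<Sum>v\<in>vertices P. \<Sum>k\<in>UNIV. (row_embed k v :: real^'d^'n)) = 0"
    using sum_vertices_P by (simp add: vec_eq_iff)
  moreover have "sum gen (vertices P \<times> UNIV) =
      (\<Sum>v\<in>vertices P. \<Sum>k\<in>UNIV. (row_embed k v, w k))"
    by (simp add: sum.cartesian_product)
  ultimately show ?thesis
    using sum_w by (simp add: prod_eq_iff fst_sum snd_sum)
qed

lemma zero_in_P: "0 \<in> P"
  using zero_in_hull_centered[OF finite_vertices_P vertices_P sum_vertices_P] P_hull by simp

lemma zero_in_Q: "0 \<in> Q"
  using zero_in_hull_centered[of UNIV w] sum_w Q_hull by simp

lemma convex_P: "convex P" and convex_Q: "convex Q"
  using P_hull Q_hull convex_convex_hull by metis+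

lemma vertices_subset: "vertices P \<subseteq> P"
  by (auto simp: vertices_def extreme_point_of_def)

lemma zero_in_wreath: "0 \<in> wreath P w"
  using zero_in_hull_centered[OF finite_index _ sum_gen] vertices_P wreath_hull by simp

lemma block_in_wreath: "p \<in> P \<Longrightarrow> (row_embed k p, w k) \<in> wreath P w"
proof -
  \<comment> \<open>The affine map onto a block is split into a linear map and a translation, each
    of which commutes with convex hulls.\<close>
  have eq: "(\<lambda>p. (row_embed k p, w k)) ` A = (\<lambda>z. (0, w k) + z) ` (\<lambda>p. (row_embed k p, 0)) ` A"
    for A :: "(real^'d) set"
    by (simp add: image_image)
  have "(\<lambda>p. (row_embed k p, w k)) ` (convex hull vertices P)
      = convex hull ((\<lambda>p. (row_embed k p, w k)) ` vertices P)"
    unfolding eq convex_hull_translation convex_hull_linear_image[OF linear_row_embed] ..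
  also have "\<dots> \<subseteq> wreath P w"
    unfolding wreath_hull by (rule hull_mono) auto
  finally show "p \<in> P \<Longrightarrow> (row_embed k p, w k) \<in> wreath P w"
    using P_hull by auto
qed

text \<open>The tight part is a face, so it is the hull of the tight generators, and each of these
  lies in a block over some \<open>B k\<close>. Conversely the blocks are tight and the face is
  convex.\<close>

lemma wreath_hyperplane_eq_join:
  assumes le: "\<And>k p. p \<in> P \<Longrightarrow> c $ k \<bullet> p + b \<bullet> w k \<le> 1"
    and B: "\<And>k. B k = {p \<in> P. c $ k \<bullet> p + b \<bullet> w k = 1}"
  shows "wreath P w \<inter> {z. (c, b) \<bullet> z = 1} = iterated_join (\<lambda>k. block k (B k) (w k))"
    and "z \<in> wreath P w \<Longrightarrow> (c, b) \<bullet> z \<le> 1"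
proof -
  let ?V = "gen ` (vertices P \<times> UNIV)"
  let ?X = "wreath P w \<inter> {z. (c, b) \<bullet> z = 1}"
  have "?V \<subseteq> {z. (c, b) \<bullet> z \<le> 1}"
    using le vertices_subset by (auto simp: inner_row_embed)
  then have "wreath P w \<subseteq> {z. (c, b) \<bullet> z \<le> 1}"
    unfolding wreath_hull by (simp add: hull_minimal convex_halfspace_le)
  then show valid: "\<And>z. z \<in> wreath P w \<Longrightarrow> (c, b) \<bullet> z \<le> 1"
    by auto
  then have face: "?X face_of convex hull ?V"
    unfolding wreath_hull by (intro face_of_Int_supporting_hyperplane_le) auto
  show "?X = iterated_join (\<lambda>k. block k (B k) (w k))"
  proof (rule antisym)
    have "?X = convex hull (?V \<inter> ?X)"
      using finite_index face by (intro hull_Int_face) auto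
    also have "\<dots> \<subseteq> convex hull (\<Union>k. block k (B k) (w k))"
      using B vertices_subset by (intro hull_mono) (fastforce simp: block_def inner_row_embed)
    finally show "?X \<subseteq> iterated_join (\<lambda>k. block k (B k) (w k))"
      by (simp add: iterated_join_eq)
    have "(\<Union>k. block k (B k) (w k)) \<subseteq> ?X"
      using B block_in_wreath by (auto simp: block_def inner_row_embed)
    then show "iterated_join (\<lambda>k. block k (B k) (w k)) \<subseteq> ?X"
      unfolding iterated_join_eq using face_of_imp_convex[OF face] by (rule hull_minimal)
  qed
qed

section \<open>The joins are facets\<close>

lemma polytope_facet_iterated_join:
  assumes G: "polytope_facet G Q" and F: "\<And>k. w k \<notin> G \<Longrightarrow> polytope_facet (F k) P"
  shows "polytope_facet (iterated_join (\<lambda>k. block k (if w k \<in> G then P else F k) (w k)))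
    (wreath P w)"
proof -
  let ?B = "\<lambda>k. if w k \<in> G then P else F k"
  let ?X = "iterated_join (\<lambda>k. block k (?B k) (w k))"
  obtain b where b: "\<And>y. y \<in> Q \<Longrightarrow> b \<bullet> y \<le> 1" "G = Q \<inter> {y. b \<bullet> y = 1}" "Q \<subseteq> span G"
    using polytope_facet_centered[of UNIV w G] G sum_w Q_hull by auto
  have "\<exists>a. (\<forall>p\<in>P. a \<bullet> p \<le> 1) \<and> F k = P \<inter> {p. a \<bullet> p = 1} \<and> P \<subseteq> span (F k)"
    if "w k \<notin> G" for k
    using polytope_facet_centered[OF finite_vertices_P vertices_P sum_vertices_P, of "F k"]
      F[OF that] unfolding P_hull[symmetric] by metis
  then obtain a where a: "\<And>k p. w k \<notin> G \<Longrightarrow> p \<in> P \<Longrightarrow> a k \<bullet> p \<le> 1"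
      "\<And>k. w k \<notin> G \<Longrightarrow> F k = P \<inter> {p. a k \<bullet> p = 1}" "\<And>k. w k \<notin> G \<Longrightarrow> P \<subseteq> span (F k)"
    by metis
  \<comment> \<open>For \<open>w k\<close> outside \<open>G\<close> the factor is the slack of
    \<open>b\<close> at \<open>w k\<close>, so block \<open>k\<close> is tight exactly on
    \<open>F k\<close>; for \<open>w k\<close> in \<open>G\<close> the slack is zero and the zero
    row makes all of \<open>P\<close> tight.\<close>
  define c :: "real^'d^'n" where "c = (\<chi> k. if w k \<in> G then 0 else (1 - b \<bullet> w k) *\<^sub>R a k)"
  have w_Q: "w k \<in> Q" for k
    using Q_hull by (simp add: hull_inc)
  have lt: "b \<bullet> w k < 1" if "w k \<notin> G" for k
    using b(1)[OF w_Q[of k]] b(2) w_Q[of k] that by auto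
  have le: "c $ k \<bullet> p + b \<bullet> w k \<le> 1" if "p \<in> P" for k p
  proof (cases "w k \<in> G")
    case False
    then have "(1 - b \<bullet> w k) * (a k \<bullet> p) \<le> (1 - b \<bullet> w k) * 1"
      using lt[of k] a(1) that by (intro mult_left_mono) auto
    then show ?thesis
      using False by (simp add: c_def)
  qed (use b in \<open>auto simp: c_def\<close>)
  have B: "?B k = {p \<in> P. c $ k \<bullet> p + b \<bullet> w k = 1}" for k
  proof (cases "w k \<in> G")
    case False
    have "(1 - b \<bullet> w k) * t + b \<bullet> w k = 1 \<longleftrightarrow> t = 1" for t
    proof -
      have "(1 - b \<bullet> w k) * t + b \<bullet> w k = 1 \<longleftrightarrow> (1 - b \<bullet> w k) * (t - 1) = 0"
        by (auto simp: algebra_simps)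
      then show ?thesis
        using lt[OF False] by simp
    qed
    then show ?thesis
      using False a(2) by (auto simp: c_def)
  qed (use b in \<open>auto simp: c_def\<close>)
  note X = wreath_hyperplane_eq_join(1)[OF le B] and valid = wreath_hyperplane_eq_join(2)[OF le B]
  have block: "(row_embed k p, w k) \<in> span ?X" if "p \<in> ?B k" for k p
  proof -
    have "(row_embed k p, w k) \<in> block k (?B k) (w k)"
      using that unfolding block_def by blast
    then show ?thesis
      unfolding iterated_join_eq by (intro span_base hull_inc) blast
  qed
  \<comment> \<open>Blocks over \<open>G\<close> contain \<open>(0, w k)\<close> because
    \<open>0 \<in> P\<close>. These vectors suffice, since the \<open>w k\<close> in
    \<open>G\<close> span \<open>G\<close> and \<open>G\<close> spans \<open>Q\<close>.\<close>
  have "(0, y) \<in> span ?X" if "y \<in> Q" for y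
  proof (rule linear_span_subset[where h = "\<lambda>y. (0, y)" and X = "G \<inter> range w"])
    show "linear (\<lambda>y. (0 :: real^'d^'n, y :: real^'e))"
      by (rule linearI) auto
    have "(0, w k) \<in> span ?X" if "w k \<in> G" for k
      using block[of 0 k] that zero_in_P by (simp add: row_embed_0)
    then show "(\<lambda>y. (0, y)) ` (G \<inter> range w) \<subseteq> span ?X"
      by auto
    have "G face_of convex hull (range w)"
      using G Q_hull by (simp add: polytope_facet_def)
    then have "G = convex hull (range w \<inter> G)"
      by (intro hull_Int_face) auto
    then have "G \<subseteq> span (G \<inter> range w)"
      using convex_hull_subset_span[of "G \<inter> range w"] by (simp add: Int_commute)
    then show "y \<in> span (G \<inter> range w)"
      using b(3) that by (meson span_minimal subsetD subspace_span)
  qed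
  then have zero_w: "(0, w k) \<in> span ?X" for k
    using w_Q by simp
  have "(row_embed k p, w k) \<in> span ?X" if "p \<in> P" for k p
  proof (cases "w k \<in> G")
    case False
    \<comment> \<open>Subtracting \<open>(0, w k)\<close> from the block over \<open>F k\<close>
      isolates row \<open>k\<close>, where \<open>F k\<close> spans \<open>P\<close>.\<close>
    have "(row_embed k p, 0 :: real^'e) \<in> span ?X"
    proof (rule linear_span_subset[OF linear_row_embed[of k], where X = "F k"])
      have "(row_embed k q, 0) \<in> span ?X" if "q \<in> F k" for q
        using span_diff[OF block[of q k] zero_w[of k]] that False by simp
      then show "(\<lambda>p. (row_embed k p, 0)) ` F k \<subseteq> span ?X"
        by auto
      show "p \<in> span (F k)"
        using a(3) False that by auto
    qed
    then show ?thesis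
      using span_add[OF _ zero_w[of k]] by fastforce
  qed (use block that in auto)
  then have "gen ` (vertices P \<times> UNIV) \<subseteq> span ?X"
    using vertices_subset by auto
  then have "wreath P w \<subseteq> span ?X"
    unfolding wreath_hull by (simp add: hull_minimal subspace_imp_convex)
  then show ?thesis
    using valid X zero_in_wreath
    by (intro polytope_facet_hyperplaneI[where a = "(c, b)"])
      (auto simp: wreath_hull)
qed

section \<open>Every facet is such a join\<close>

lemma polytope_facet_wreathD:
  assumes "polytope_facet X (wreath P w)"
  shows "\<exists>G F. polytope_facet G Q \<and> (\<forall>k. w k \<notin> G \<longrightarrow> polytope_facet (F k) P) \<and>
    X = iterated_join (\<lambda>k. block k (if w k \<in> G then P else F k) (w k))"
proof -
  obtain cb where cb: "\<And>z. z \<in> wreath P w \<Longrightarrow> cb \<bullet> z \<le> 1"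
      "X = wreath P w \<inter> {z. cb \<bullet> z = 1}" "wreath P w \<subseteq> span X"
    using polytope_facet_centered[OF finite_index _ sum_gen, of X] assms vertices_P
    unfolding wreath_hull[symmetric] by auto
  obtain c b where [simp]: "cb = (c, b)"
    by (cases cb)
  have le: "c $ k \<bullet> p + b \<bullet> w k \<le> 1" if "p \<in> P" for k p
    using cb(1)[OF block_in_wreath[OF that]] by (simp add: inner_row_embed)
  define G where "G = Q \<inter> {y. b \<bullet> y = 1}"
  define F where "F k = {p \<in> P. c $ k \<bullet> p + b \<bullet> w k = 1}" for k
  \<comment> \<open>This inverts the scaling by the slack of \<open>b\<close>; it is used only for
    \<open>w k\<close> outside \<open>G\<close>, where the denominator is positive.\<close>
  define a where "a k = (1 / (1 - b \<bullet> w k)) *\<^sub>R (c $ k)" for k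
  have w_Q: "w k \<in> Q" for k
    using Q_hull by (simp add: hull_inc)
  have w_le: "b \<bullet> w k \<le> 1" for k
    using le[OF zero_in_P] by simp
  have lt: "b \<bullet> w k < 1" if "w k \<notin> G" for k
    using w_le[of k] w_Q[of k] that by (auto simp: G_def)
  \<comment> \<open>Here \<open>b\<close> has no slack at \<open>w k\<close>, so
    \<open>c $ k\<close> is nonpositive on \<open>P\<close>, and centering forces it to vanish
    there.\<close>
  have F_P: "F k = P" if "w k \<in> G" for k
  proof -
    have "c $ k \<bullet> p = 0" if "p \<in> P" for p
      using \<open>w k \<in> G\<close> le[of _ k] vertices_subset that P_hull sum_vertices_P finite_vertices_P
      by (intro nonpos_on_centered_eq_0[of "vertices P" id]) (auto simp: G_def)
    then show ?thesis
      using that by (auto simp: F_def G_def)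
  qed
  have X: "X = iterated_join (\<lambda>k. block k (F k) (w k))"
    using wreath_hyperplane_eq_join(1)[OF le F_def] cb(2) by simp
  \<comment> \<open>The blocks over the \<open>F k\<close> span the wreath product, so a linear map
    need only be checked on them.\<close>
  have span_X: "h z \<in> span Y"
    if "linear h" "z \<in> wreath P w" "\<And>k p. p \<in> F k \<Longrightarrow> h (row_embed k p, w k) \<in> span Y"
    for h :: "_ \<Rightarrow> 'x::euclidean_space" and z Y
  proof (rule linear_span_subset[OF \<open>linear h\<close>])
    show "h ` (\<Union>k. block k (F k) (w k)) \<subseteq> span Y"
      using that by (auto simp: block_def)
    have "X \<subseteq> span (\<Union>k. block k (F k) (w k))"
      unfolding X iterated_join_eq by (rule convex_hull_subset_span)
    then show "z \<in> span (\<Union>k. block k (F k) (w k))"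
      using cb(3) that(2) by (meson span_minimal subsetD subspace_span)
  qed
  have a_1: "a k \<bullet> p = 1 \<longleftrightarrow> c $ k \<bullet> p + b \<bullet> w k = 1" and
    a_le: "p \<in> P \<Longrightarrow> a k \<bullet> p \<le> 1" if "w k \<notin> G" for k p
    using lt[OF that] le[of p k] by (auto simp: a_def divide_simps)
  have "polytope_facet (F k) P" if "w k \<notin> G" for k
  proof (rule polytope_facet_hyperplaneI[OF convex_P zero_in_P a_le[OF that]])
    show "F k = P \<inter> {p. a k \<bullet> p = 1}"
      using a_1[OF that] by (auto simp: F_def)
    have "p \<in> span (F k)" if "p \<in> P" for p
    proof -
      \<comment> \<open>Projection to row \<open>k\<close> sends block \<open>k\<close> to
        \<open>F k\<close> and all other blocks to \<open>0\<close>.\<close>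
      have "linear (\<lambda>z :: (real^'d^'n) \<times> (real^'e). fst z $ k)"
        by (rule linearI) auto
      from span_X[OF this block_in_wreath[OF that, of k], of "F k"]
      show ?thesis
        by (simp add: row_embed_nth span_base span_0)
    qed
    then show "P \<subseteq> span (F k)"
      by blast
  qed
  moreover have "polytope_facet G Q"
  proof (rule polytope_facet_hyperplaneI[OF convex_Q zero_in_Q _ G_def])
    have "Q \<subseteq> {y. b \<bullet> y \<le> 1}"
      unfolding Q_hull using w_le by (intro hull_minimal) (auto simp: convex_halfspace_le)
    then show "b \<bullet> y \<le> 1" if "y \<in> Q" for y
      using that by blast
    \<comment> \<open>This map fixes the vector part on blocks over \<open>G\<close>. On a block
      over \<open>F k\<close> with \<open>w k\<close> outside \<open>G\<close> it is zero, because
      there \<open>a k \<bullet> p = 1\<close>.\<close>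
    define h :: "(real^'d^'n) \<times> (real^'e) \<Rightarrow> real^'e"
      where "h z = snd z - (\<Sum>k\<in>{k. w k \<notin> G}. (a k \<bullet> fst z $ k) *\<^sub>R w k)" for z
    have "linear h"
      by (rule linearI)
        (auto simp: h_def inner_right_distrib scaleR_add_left sum.distrib scaleR_sum_right
          scaleR_diff_right)
    have h: "h (row_embed k p, w k) = w k - (if w k \<in> G then 0 else (a k \<bullet> p) *\<^sub>R w k)" for k p
    proof -
      have "(\<Sum>i\<in>{k. w k \<notin> G}. (a i \<bullet> row_embed k p $ i) *\<^sub>R w i)
          = (\<Sum>i\<in>{k. w k \<notin> G}. if i = k then (a k \<bullet> p) *\<^sub>R w k else 0)"
        by (intro sum.cong) (auto simp: row_embed_nth)
      then show ?thesis
        by (simp add: h_def)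
    qed
    have "w k \<in> span G" for k
    proof -
      \<comment> \<open>At the row \<open>0\<close> the correction term vanishes, so
        \<open>h\<close> returns \<open>w k\<close> itself, whether or not it lies in
        \<open>G\<close>.\<close>
      have "h (row_embed k 0, w k) \<in> span G"
      proof (rule span_X[OF \<open>linear h\<close> block_in_wreath[OF zero_in_P]])
        show "h (row_embed i p, w i) \<in> span G" if "p \<in> F i" for i p
          using that a_1[of i p] by (auto simp: h F_def span_base span_0)
      qed
      then show ?thesis
        by (simp add: h split: if_splits)
    qed
    then show "Q \<subseteq> span G"
      unfolding Q_hull by (intro hull_minimal) (auto simp: subspace_imp_convex)
  qed
  moreover have "X = iterated_join (\<lambda>k. block k (if w k \<in> G then P else F k) (w k))"
    unfolding X using F_P by (intro arg_cong[of _ _ iterated_join] ext) auto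
  ultimately show ?thesis
    by blast
qed

end

theorem proposition2p2:
  fixes D :: "'d::finite set" and E :: "'e::finite set"
    and P :: "(real^'d) set" and Q :: "(real^'e) set"
    and w :: "'n::finite \<Rightarrow> real^'e"
  assumes "full_dim_polytope D P" and "full_dim_polytope E Q"
    and "vertex_barycenter P = 0" and "vertex_barycenter Q = 0"
    and "bij_betw w UNIV (vertices Q)"
  shows "(\<forall>G F. polytope_facet G Q
              \<and> (\<forall>k. w k \<notin> vertices G \<longrightarrow> polytope_facet (F k) P)
            \<longrightarrow> polytope_facet
                  (iterated_join (\<lambda>k. block k (if w k \<in> vertices G then P else F k) (w k)))
                  (wreath P w))
       \<and> (\<forall>X. polytope_facet X (wreath P w)
            \<longrightarrow> (\<exists>G F. polytope_facet G Q
                  \<and> (\<forall>k. w k \<notin> vertices G \<longrightarrow> polytope_facet (F k) P)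
                  \<and> X = iterated_join
                          (\<lambda>k. block k (if w k \<in> vertices G then P else F k) (w k))))"
proof -
  note P = full_dim_polytope_centered[OF assms(1,3)]
    and Q = full_dim_polytope_centered[OF assms(2,4)]
  have range: "range w = vertices Q"
    using assms(5) by (simp add: bij_betw_def)
  interpret centered_wreath P Q w
  proof
    show "Q = convex hull (range w)"
      using Q(1) range by simp
    show "sum w UNIV = 0"
      using sum.reindex_bij_betw[OF assms(5), of id] Q(4) by simp
  qed (use P in auto)
  \<comment> \<open>The locale tests membership in \<open>G\<close>, the theorem membership in
    \<open>vertices G\<close>; they agree since \<open>w k\<close> is a vertex of \<open>Q\<close>
    and \<open>G\<close> is a face.\<close>
  have vertices_G: "w k \<in> vertices G \<longleftrightarrow> w k \<in> G" if "polytope_facet G Q" for k G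
    using that vertices_face[of G Q "w k"] range by (auto simp: polytope_facet_def)
  show ?thesis
  proof (intro conjI allI impI)
    fix G F
    assume *: "polytope_facet G Q \<and> (\<forall>k. w k \<notin> vertices G \<longrightarrow> polytope_facet (F k) P)"
    then show "polytope_facet
        (iterated_join (\<lambda>k. block k (if w k \<in> vertices G then P else F k) (w k))) (wreath P w)"
      using polytope_facet_iterated_join[of G F] by (simp add: vertices_G)
  next
    fix X
    assume "polytope_facet X (wreath P w)"
    from polytope_facet_wreathD[OF this]
    show "\<exists>G F. polytope_facet G Q \<and> (\<forall>k. w k \<notin> vertices G \<longrightarrow> polytope_facet (F k) P) \<and>
        X = iterated_join (\<lambda>k. block k (if w k \<in> vertices G then P else F k) (w k))"
      by (auto simp: vertices_G cong: conj_cong)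
  qed
qed

end
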